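(* For every $t\in\mathbb{N}$ and every $\beta=(\beta_3,\beta_4,\dots,\beta_t)\in\mathbb{C}^{t-2}$, the Leibniz algebra $R_2(F,1,\beta)$ is complete.
   Context: A Leibniz algebra is an algebra with bilinear product $[\cdot,\cdot]$ satisfying $[a,[b,c]]=[[a,b],c]-[[a,c],b]$ for all $a,b,c$. $R_2(F,1,\beta)$ is the Leibniz algebra over $\mathbb{C}$ with basis $\{x,e_1,e_2,\dots\}$ (elements are finite linear combinations of basis elements) and products $$[e_i,e_1]=e_{i+1}\ (i\ge 2),\quad [x,e_1]=-e_1+e_2,\quad [e_1,x]=e_1,\quad [e_i,x]=(i-1)e_i+\sum_{k=3}^{t}\beta_k e_{k+i-2}\ (i\ge 2),\quad [x,x]=\sum_{k=2}^{t-1}\beta_{k+1}e_k,$$ all other products of basis elements being zero; empty sums are zero. A derivation of $L$ is a linear map $d:L\to L$ with $d([a,b])=[d(a),b]+[a,d(b)]$; it is inner if it equals the right multiplication $b\mapsto[b,a]$ for some $a\in L$. The center is $\{a\in L: [a,b]=[b,a]=0\text{ for all }b\in L\}$. $L$ is complete if its center is zero and all its derivations are inner. *)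

theory Defs
  imports Complex_Main "HOL-Library.Poly_Mapping"
begin

locale leibniz_algebra = vector_space scale
  for scale :: "'k::field \<Rightarrow> 'v::ab_group_add \<Rightarrow> 'v" +
  fixes brk :: "'v \<Rightarrow> 'v \<Rightarrow> 'v"
  assumes linear_left: "Vector_Spaces.linear scale scale (\<lambda>a. brk a b)"
    and linear_right: "Vector_Spaces.linear scale scale (\<lambda>b. brk a b)"
    and leibniz_identity: "brk a (brk b c) = brk (brk a b) c - brk (brk a c) b"
begin

definition derivation :: "('v \<Rightarrow> 'v) \<Rightarrow> bool" where
  "derivation d \<longleftrightarrow> Vector_Spaces.linear scale scale d \<and>
     (\<forall>a b. d (brk a b) = brk (d a) b + brk a (d b))"

definition inner :: "('v \<Rightarrow> 'v) \<Rightarrow> bool" where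
  "inner d \<longleftrightarrow> (\<exists>a. d = (\<lambda>b. brk b a))"

definition center :: "'v set" where
  "center = {a. \<forall>b. brk a b = 0 \<and> brk b a = 0}"

definition complete_algebra :: bool where
  "complete_algebra \<longleftrightarrow> center = {0} \<and> (\<forall>d. derivation d \<longrightarrow> inner d)"

end

text \<open>
  The underlying space consists of the finitely supported functions on the natural numbers.
  The unit vector at \<open>0\<close> plays the role of \<open>x\<close>, the unit vector at \<open>i \<ge> 1\<close> that of \<open>e\<^sub>i\<close>.
\<close>

type_synonym r2_space = "nat \<Rightarrow>\<^sub>0 complex"

definition r2_scale :: "complex \<Rightarrow> r2_space \<Rightarrow> r2_space" where
  "r2_scale c v = Poly_Mapping.map ((*) c) v"

definition r2_x :: r2_space where
  "r2_x = Poly_Mapping.single 0 1"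

definition r2_e :: "nat \<Rightarrow> r2_space" where
  "r2_e i = Poly_Mapping.single i 1"

text \<open>
  Product of the basis vectors with indices \<open>i\<close> and \<open>j\<close> (index \<open>0\<close> standing for \<open>x\<close>).
  Only the values \<open>\<beta> 3, \<dots>, \<beta> t\<close> are used; for \<open>t \<le> 2\<close> all the sums are empty.
\<close>

definition r2_basis_brk :: "nat \<Rightarrow> (nat \<Rightarrow> complex) \<Rightarrow> nat \<Rightarrow> nat \<Rightarrow> r2_space" where
  "r2_basis_brk t \<beta> i j =
     (if i \<ge> 2 \<and> j = 1 then r2_e (i + 1)
      else if i = 0 \<and> j = 1 then - r2_e 1 + r2_e 2
      else if i = 1 \<and> j = 0 then r2_e 1
      else if i \<ge> 2 \<and> j = 0 then
        r2_scale (of_nat i - 1) (r2_e i) + (\<Sum>k=3..t. r2_scale (\<beta> k) (r2_e (k + i - 2)))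
      else if i = 0 \<and> j = 0 then (\<Sum>k=2..t-1. r2_scale (\<beta> (k + 1)) (r2_e k))
      else 0)"

text \<open>The bilinear extension of the products of basis vectors.\<close>

definition r2_brk :: "nat \<Rightarrow> (nat \<Rightarrow> complex) \<Rightarrow> r2_space \<Rightarrow> r2_space \<Rightarrow> r2_space" where
  "r2_brk t \<beta> a b =
     (\<Sum>i\<in>Poly_Mapping.keys a. \<Sum>j\<in>Poly_Mapping.keys b.
        r2_scale (Poly_Mapping.lookup a i * Poly_Mapping.lookup b j) (r2_basis_brk t \<beta> i j))"

lemma lookup_r2_scale [simp]:
  "Poly_Mapping.lookup (r2_scale c v) i = c * Poly_Mapping.lookup v i"
  by (simp add: r2_scale_def Poly_Mapping.map.rep_eq when_def)

lemma r2_scale_zero_right [simp]: "r2_scale c 0 = 0"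
  by (rule poly_mapping_eqI) simp

lemma vector_space_r2_scale: "vector_space r2_scale"
  by unfold_locales (auto intro!: poly_mapping_eqI simp: lookup_add algebra_simps)

lemma r2_brk_single:
  "r2_brk t \<beta> (Poly_Mapping.single i 1) (Poly_Mapping.single j 1) = r2_basis_brk t \<beta> i j"
  by (auto simp: r2_brk_def intro!: poly_mapping_eqI)

lemma r2_brk_products:
  "i \<ge> 2 \<Longrightarrow> r2_brk t \<beta> (r2_e i) (r2_e 1) = r2_e (i + 1)"
  "r2_brk t \<beta> r2_x (r2_e 1) = - r2_e 1 + r2_e 2"
  "r2_brk t \<beta> (r2_e 1) r2_x = r2_e 1"
  "i \<ge> 2 \<Longrightarrow> r2_brk t \<beta> (r2_e i) r2_x =
     r2_scale (of_nat i - 1) (r2_e i) + (\<Sum>k=3..t. r2_scale (\<beta> k) (r2_e (k + i - 2)))"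
  "r2_brk t \<beta> r2_x r2_x = (\<Sum>k=2..t-1. r2_scale (\<beta> (k + 1)) (r2_e k))"
  "r2_brk t \<beta> (r2_e 1) (r2_e 1) = 0"
  "j \<ge> 2 \<Longrightarrow> r2_brk t \<beta> a (r2_e j) = 0"
proof -
  show "r2_brk t \<beta> a (r2_e j) = 0" if "j \<ge> 2"
    using that by (simp add: r2_brk_def r2_e_def r2_basis_brk_def)
qed (simp_all add: r2_x_def r2_e_def r2_brk_single r2_basis_brk_def del: single_one One_nat_def)

end

theory Submission
  imports Defs
begin

text \<open>
  Write \<open>x = e\<^sub>0\<close>, so that \<open>a\<^sub>i\<close> is the coordinate of \<open>a\<close> at \<open>e\<^sub>i\<close> for all \<open>i \<ge> 0\<close>.
  All brackets \<open>[a, e\<^sub>j]\<close> with \<open>j \<ge> 2\<close> vanish, so the right multiplication by \<open>b\<close> is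
  \<open>b\<^sub>0 X + b\<^sub>1 E\<close>, where \<open>X = [\<cdot>, x]\<close> and \<open>E = [\<cdot>, e\<^sub>1]\<close>; this is \<open>r2_brk_expand_right\<close>.  The
  Leibniz identity thereby reduces to the single commutator relation \<open>XE - EX = E\<close>
  (\<open>r2_brk_commutator\<close>), which is checked on the basis.  The center is zero because \<open>[e\<^sub>2, a]\<close>
  determines \<open>a\<^sub>0, a\<^sub>1\<close> and \<open>E\<close> shifts the remaining coordinates injectively.

  For the derivations, let \<open>d\<close> be a derivation and subtract from it the right multiplication by
  \<open>s x - q e\<^sub>1\<close>, where \<open>q\<close> and \<open>s\<close> are the \<open>e\<^sub>1\<close>-coordinates of \<open>d x\<close> and \<open>d e\<^sub>1\<close>.  The difference
  is a derivation for which both these coordinates are zero, and such a derivation is zero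
  (\<open>r2_derivation_eq_zero\<close>).  Indeed \<open>[e\<^sub>1, e\<^sub>1] = 0\<close> forces \<open>d e\<^sub>1 = 0\<close>, so \<open>d\<close> commutes with \<open>E\<close>,
  and \<open>[e\<^sub>1, x] = e\<^sub>1\<close> forces \<open>u = d x\<close> to lie in the span of \<open>e\<^sub>2, e\<^sub>3, \<dots>\<close>.  On that span
  \<open>X = N + \<Sum>\<^sub>k \<beta>\<^sub>k E\<^bsup>k-2\<^esup>\<close> with \<open>N e\<^sub>i = (i - 1) e\<^sub>i\<close>, and \<open>d e\<^sub>k = E\<^bsup>k-1\<^esup> u\<close> for \<open>k \<ge> 2\<close>.  Applying
  \<open>d\<close> to \<open>[x, x] = \<Sum>\<^sub>k \<beta>\<^bsub>k+1\<^esub> e\<^sub>k\<close> therefore gives \<open>\<Sum>\<^sub>k \<beta>\<^sub>k E\<^bsup>k-2\<^esup> u\<close> on one side and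
  \<open>X u = N u + \<Sum>\<^sub>k \<beta>\<^sub>k E\<^bsup>k-2\<^esup> u\<close> on the other.  Hence \<open>N u = 0\<close>, which makes \<open>u = 0\<close>.  As \<open>x\<close> and
  \<open>e\<^sub>1\<close> generate the algebra, \<open>d = 0\<close>.
\<close>

section \<open>Derivations of Leibniz algebras\<close>

context leibniz_algebra
begin

lemma derivation_right_mult: "derivation (\<lambda>b. brk b a)"
  unfolding derivation_def using linear_left leibniz_identity
  by (metis (no_types, lifting) add.commute diff_add_cancel)

lemma derivation_diff:
  assumes f: "derivation f" and g: "derivation g"
  shows "derivation (\<lambda>v. f v - g v)"
proof -
  interpret V: vector_space_pair scale scale by unfold_locales
  have "Vector_Spaces.linear scale scale (\<lambda>v. f v - g v)"
    using f g by (intro V.linear_compose_sub) (auto simp: derivation_def)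
  moreover have "brk (v - w) b = brk v b - brk w b" for v w b
    using V.linear_diff[OF linear_left] .
  moreover have "brk b (v - w) = brk b v - brk b w" for v w b
    using V.linear_diff[OF linear_right] .
  ultimately show ?thesis
    using f g by (simp add: derivation_def)
qed

end

section \<open>The bracket in coordinates\<close>

interpretation r2: vector_space r2_scale
  by (rule vector_space_r2_scale)

interpretation r2_pair: vector_space_pair r2_scale r2_scale
  by unfold_locales

lemma lookup_r2_e [simp]: "Poly_Mapping.lookup (r2_e i) j = (if i = j then 1 else 0)"
  by (simp add: r2_e_def lookup_single when_def)

lemma r2_expansion:
  "v = (\<Sum>i\<in>Poly_Mapping.keys v. r2_scale (Poly_Mapping.lookup v i) (r2_e i))"
  by (rule poly_mapping_eqI) (simp add: lookup_sum if_distrib sum.delta' in_keys_iff cong: if_cong)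

text \<open>
  Restricting the basis case to the support of \<open>v\<close> makes the rule applicable to identities that
  hold only on a coordinate subspace.
\<close>

lemma r2_induct_keys:
  assumes zero: "P 0"
    and add: "\<And>v w. P v \<Longrightarrow> P w \<Longrightarrow> P (v + w)"
    and basis: "\<And>c i. i \<in> Poly_Mapping.keys v \<Longrightarrow> P (r2_scale c (r2_e i))"
  shows "P v"
proof -
  have "P (\<Sum>i\<in>A. r2_scale (Poly_Mapping.lookup v i) (r2_e i))"
    if "finite A" "A \<subseteq> Poly_Mapping.keys v" for A
    using that by (induction A rule: finite_induct) (auto intro: zero add basis)
  from this[of "Poly_Mapping.keys v"] show ?thesis
    by (simp flip: r2_expansion)
qed

lemma r2_linearI:
  assumes "\<And>v w. f (v + w) = f v + f w" "\<And>c v. f (r2_scale c v) = r2_scale c (f v)"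
  shows "Vector_Spaces.linear r2_scale r2_scale f"
  using assms by (simp add: Vector_Spaces.linear_iff vector_space_r2_scale)

lemma r2_linear_eqI:
  assumes f: "Vector_Spaces.linear r2_scale r2_scale f"
    and g: "Vector_Spaces.linear r2_scale r2_scale g"
    and eq: "\<And>i. i \<in> Poly_Mapping.keys v \<Longrightarrow> f (r2_e i) = g (r2_e i)"
  shows "f v = g v"
  by (rule r2_induct_keys[where P = "\<lambda>v. f v = g v"])
     (simp_all add: eq r2_pair.linear_0[OF f] r2_pair.linear_0[OF g]
        r2_pair.linear_add[OF f] r2_pair.linear_add[OF g]
        r2_pair.linear_scale[OF f] r2_pair.linear_scale[OF g])

text \<open>
  The supports in the definition of the bracket vary with its arguments; summing over common
  larger index sets is what makes bilinearity visible.
\<close>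

lemma r2_brk_superset:
  assumes "finite A" "Poly_Mapping.keys a \<subseteq> A" "finite B" "Poly_Mapping.keys b \<subseteq> B"
  shows "r2_brk t \<beta> a b = (\<Sum>i\<in>A. \<Sum>j\<in>B.
    r2_scale (Poly_Mapping.lookup a i * Poly_Mapping.lookup b j) (r2_basis_brk t \<beta> i j))"
proof -
  have "r2_brk t \<beta> a b = (\<Sum>i\<in>Poly_Mapping.keys a. \<Sum>j\<in>B.
    r2_scale (Poly_Mapping.lookup a i * Poly_Mapping.lookup b j) (r2_basis_brk t \<beta> i j))"
    unfolding r2_brk_def
    by (intro sum.cong refl sum.mono_neutral_left) (use assms in \<open>auto simp: in_keys_iff\<close>)
  also have "\<dots> = (\<Sum>i\<in>A. \<Sum>j\<in>B.
    r2_scale (Poly_Mapping.lookup a i * Poly_Mapping.lookup b j) (r2_basis_brk t \<beta> i j))"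
    by (intro sum.mono_neutral_left) (use assms in \<open>auto simp: in_keys_iff\<close>)
  finally show ?thesis .
qed

lemma keys_r2_scale: "Poly_Mapping.keys (r2_scale c v) \<subseteq> Poly_Mapping.keys v"
  by (auto simp: in_keys_iff)

lemma linear_r2_brk_left:
  "Vector_Spaces.linear r2_scale r2_scale (\<lambda>a. r2_brk t \<beta> a b)"
proof (rule r2_linearI)
  fix v w :: r2_space and c :: complex
  let ?A = "Poly_Mapping.keys v \<union> Poly_Mapping.keys w" and ?B = "Poly_Mapping.keys b"
  have sup: "finite ?A" "finite ?B" by simp_all
  show "r2_brk t \<beta> (v + w) b = r2_brk t \<beta> v b + r2_brk t \<beta> w b"
    using sup keys_add[of v w]
    by (simp add: r2_brk_superset[of ?A _ ?B] lookup_add distrib_right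
        r2.scale_left_distrib sum.distrib)
  show "r2_brk t \<beta> (r2_scale c v) b = r2_scale c (r2_brk t \<beta> v b)"
    using keys_r2_scale[of c v]
    by (simp add: r2_brk_superset[of "Poly_Mapping.keys v" _ ?B] r2.scale_sum_right mult.assoc)
qed

lemma linear_r2_brk_right:
  "Vector_Spaces.linear r2_scale r2_scale (\<lambda>b. r2_brk t \<beta> a b)"
proof (rule r2_linearI)
  fix v w :: r2_space and c :: complex
  let ?A = "Poly_Mapping.keys v \<union> Poly_Mapping.keys w" and ?B = "Poly_Mapping.keys a"
  have sup: "finite ?A" "finite ?B" by simp_all
  show "r2_brk t \<beta> a (v + w) = r2_brk t \<beta> a v + r2_brk t \<beta> a w"
    using sup keys_add[of v w]
    by (simp add: r2_brk_superset[of ?B _ ?A] lookup_add distrib_left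
        r2.scale_left_distrib sum.distrib)
  show "r2_brk t \<beta> a (r2_scale c v) = r2_scale c (r2_brk t \<beta> a v)"
    using keys_r2_scale[of c v]
    by (simp add: r2_brk_superset[of ?B _ "Poly_Mapping.keys v"] r2.scale_sum_right
        mult.left_commute)
qed

lemmas r2_brk_left_simps =
  r2_pair.linear_0[OF linear_r2_brk_left] r2_pair.linear_add[OF linear_r2_brk_left]
  r2_pair.linear_diff[OF linear_r2_brk_left] r2_pair.linear_neg[OF linear_r2_brk_left]
  r2_pair.linear_scale[OF linear_r2_brk_left] r2_pair.linear_sum[OF linear_r2_brk_left]

lemmas r2_brk_right_simps =
  r2_pair.linear_0[OF linear_r2_brk_right] r2_pair.linear_add[OF linear_r2_brk_right]
  r2_pair.linear_scale[OF linear_r2_brk_right]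

lemma r2_brk_e: "r2_brk t \<beta> (r2_e i) (r2_e j) = r2_basis_brk t \<beta> i j"
  unfolding r2_e_def by (rule r2_brk_single)

text \<open>
  Every right multiplication is a combination of the two operators \<open>[\<cdot>, x]\<close> and \<open>[\<cdot>, e\<^sub>1]\<close>.
\<close>

lemma r2_brk_expand_right:
  "r2_brk t \<beta> a b = r2_scale (Poly_Mapping.lookup b 0) (r2_brk t \<beta> a (r2_e 0))
     + r2_scale (Poly_Mapping.lookup b 1) (r2_brk t \<beta> a (r2_e 1))"
proof (rule r2_induct_keys[where v = b])
  fix c and i :: nat
  consider "i = 0" | "i = 1" | "i \<ge> 2" by linarith
  then show "r2_brk t \<beta> a (r2_scale c (r2_e i))
      = r2_scale (Poly_Mapping.lookup (r2_scale c (r2_e i)) 0) (r2_brk t \<beta> a (r2_e 0))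
      + r2_scale (Poly_Mapping.lookup (r2_scale c (r2_e i)) 1) (r2_brk t \<beta> a (r2_e 1))"
    by cases (simp_all add: r2_brk_right_simps r2_brk_products(7))
qed (simp_all add: r2_brk_right_simps lookup_add r2.scale_left_distrib)

lemma lookup_r2_brk_e1:
  "Poly_Mapping.lookup (r2_brk t \<beta> a (r2_e 1)) m =
     (if m = 0 then 0 else if m = 1 then - Poly_Mapping.lookup a 0
      else if m = 2 then Poly_Mapping.lookup a 0 else Poly_Mapping.lookup a (m - 1))"
proof (rule r2_induct_keys[where v = a])
  fix c and i :: nat
  consider "i = 0" | "i = 1" | "i \<ge> 2" by linarith
  then show "Poly_Mapping.lookup (r2_brk t \<beta> (r2_scale c (r2_e i)) (r2_e 1)) m =
     (if m = 0 then 0 else if m = 1 then - Poly_Mapping.lookup (r2_scale c (r2_e i)) 0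
      else if m = 2 then Poly_Mapping.lookup (r2_scale c (r2_e i)) 0
      else Poly_Mapping.lookup (r2_scale c (r2_e i)) (m - 1))"
    by cases (auto simp: r2_brk_left_simps r2_brk_e r2_basis_brk_def lookup_add lookup_minus)
qed (simp_all add: r2_brk_left_simps lookup_add)

lemma lookup_r2_brk_x_01:
  shows lookup_r2_brk_x_0: "Poly_Mapping.lookup (r2_brk t \<beta> a (r2_e 0)) 0 = 0"
    and lookup_r2_brk_x_1:
      "Poly_Mapping.lookup (r2_brk t \<beta> a (r2_e 0)) 1 = Poly_Mapping.lookup a 1"
proof -
  have "Poly_Mapping.lookup (r2_brk t \<beta> a (r2_e 0)) 0 = 0 \<and>
    Poly_Mapping.lookup (r2_brk t \<beta> a (r2_e 0)) 1 = Poly_Mapping.lookup a 1"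
  proof (rule r2_induct_keys[where v = a])
    fix c and i :: nat
    have sum0: "(\<Sum>k=3..t. \<beta> k * (if k + i - 2 = Suc 0 then 1 else 0)) = 0" if "i \<ge> 2"
      using that by (intro sum.neutral) auto
    consider "i = 0" | "i = 1" | "i \<ge> 2" by linarith
    then show "Poly_Mapping.lookup (r2_brk t \<beta> (r2_scale c (r2_e i)) (r2_e 0)) 0 = 0 \<and>
      Poly_Mapping.lookup (r2_brk t \<beta> (r2_scale c (r2_e i)) (r2_e 0)) 1
        = Poly_Mapping.lookup (r2_scale c (r2_e i)) 1"
      by cases (use sum0 in
        \<open>auto simp: r2_brk_left_simps r2_brk_e r2_basis_brk_def lookup_add lookup_sum\<close>)
  qed (simp_all add: r2_brk_left_simps lookup_add)
  then show "Poly_Mapping.lookup (r2_brk t \<beta> a (r2_e 0)) 0 = 0"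
    "Poly_Mapping.lookup (r2_brk t \<beta> a (r2_e 0)) 1 = Poly_Mapping.lookup a 1"
    by auto
qed

section \<open>The Leibniz identity\<close>

lemma r2_sum_shift:
  fixes f :: "nat \<Rightarrow> 'a::comm_monoid_add"
  shows "(\<Sum>k=2..t-1. f (Suc k)) = (\<Sum>k=3..t. f k)"
  by (rule sum.reindex_bij_witness[of _ "\<lambda>k. k - 1" Suc]) auto

text \<open>
  On \<open>e\<^sub>i\<close> with \<open>i \<ge> 2\<close> the \<open>\<beta>\<close>-terms cancel because they commute with the shift, leaving
  \<open>i - (i - 1) = 1\<close>; on \<open>x\<close> they cancel because \<open>[x, x]\<close> is the backward shift of those in
  \<open>[e\<^sub>2, x]\<close>.
\<close>

lemma r2_brk_commutator:
  "r2_brk t \<beta> (r2_brk t \<beta> a (r2_e 1)) (r2_e 0) - r2_brk t \<beta> (r2_brk t \<beta> a (r2_e 0)) (r2_e 1)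
     = r2_brk t \<beta> a (r2_e 1)"
proof (rule r2_linear_eqI[where v = a])
  let ?X = "\<lambda>a. r2_brk t \<beta> a (r2_e 0)" and ?E = "\<lambda>a. r2_brk t \<beta> a (r2_e 1)"
  show "Vector_Spaces.linear r2_scale r2_scale (\<lambda>a. ?X (?E a) - ?E (?X a))"
    by (rule r2_linearI)
       (simp_all add: r2_brk_left_simps r2.scale_right_diff_distrib)
  fix i :: nat
  consider "i = 0" | "i = 1" | "i \<ge> 2" by linarith
  then show "?X (?E (r2_e i)) - ?E (?X (r2_e i)) = ?E (r2_e i)"
  proof cases
    case 1
    have "?E (?X (r2_e 0)) = (\<Sum>k=2..t-1. r2_scale (\<beta> (Suc k)) (r2_e (Suc k)))"
      by (simp add: r2_brk_e r2_basis_brk_def r2_brk_left_simps)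
    also have "\<dots> = (\<Sum>k=3..t. r2_scale (\<beta> k) (r2_e k))"
      by (rule r2_sum_shift)
    finally show ?thesis using 1
      by (simp add: r2_brk_e r2_basis_brk_def r2_brk_left_simps)
  next
    case 2
    then show ?thesis
      by (simp add: r2_brk_e r2_basis_brk_def r2_brk_left_simps)
  next
    case 3
    have shift: "?E (\<Sum>k=3..t. r2_scale (\<beta> k) (r2_e (k + i - 2)))
        = (\<Sum>k=3..t. r2_scale (\<beta> k) (r2_e (k + (i + 1) - 2)))"
      unfolding r2_brk_left_simps
      by (intro sum.cong refl)
         (use 3 in \<open>auto simp: r2_brk_e r2_basis_brk_def intro!: arg_cong[where f = r2_e]\<close>)
    have X: "?X (r2_e j) = r2_scale (of_nat j - 1) (r2_e j)
        + (\<Sum>k=3..t. r2_scale (\<beta> k) (r2_e (k + j - 2)))" if "j \<ge> 2" for j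
      using that by (simp add: r2_brk_e r2_basis_brk_def)
    have E: "?E (r2_e i) = r2_e (i + 1)"
      using 3 by (simp add: r2_brk_e r2_basis_brk_def)
    have X': "?X (r2_e (i + 1)) = r2_scale (of_nat i) (r2_e (i + 1))
        + (\<Sum>k=3..t. r2_scale (\<beta> k) (r2_e (k + (i + 1) - 2)))"
      using X[of "i + 1"] 3 by simp
    have E': "?E (?X (r2_e i)) = r2_scale (of_nat i - 1) (r2_e (i + 1))
        + (\<Sum>k=3..t. r2_scale (\<beta> k) (r2_e (k + (i + 1) - 2)))"
      unfolding X[OF 3] shift[symmetric] r2_brk_left_simps(2,5) E ..
    show ?thesis
      unfolding E X' E' by (simp add: r2.scale_left_diff_distrib)
  qed
qed (rule linear_r2_brk_left)

text \<open>
  Expanding \<open>b\<close> and \<open>c\<close> along \<open>X\<close> and \<open>E\<close>, both sides of the Leibniz identity become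
  \<open>b\<^sub>1 c\<^sub>0 - b\<^sub>0 c\<^sub>1\<close> times the two sides of the commutator relation.
\<close>

lemma leibniz_algebra_r2: "leibniz_algebra r2_scale (r2_brk t \<beta>)"
proof (intro leibniz_algebra.intro leibniz_algebra_axioms.intro)
  show "vector_space r2_scale" by (rule vector_space_r2_scale)
  show "Vector_Spaces.linear r2_scale r2_scale (\<lambda>a. r2_brk t \<beta> a b)" for b
    by (rule linear_r2_brk_left)
  show "Vector_Spaces.linear r2_scale r2_scale (\<lambda>b. r2_brk t \<beta> a b)" for a
    by (rule linear_r2_brk_right)
  fix a b c :: r2_space
  let ?X = "\<lambda>a. r2_brk t \<beta> a (r2_e 0)" and ?E = "\<lambda>a. r2_brk t \<beta> a (r2_e 1)"
  define b0 b1 c0 c1 where "b0 = Poly_Mapping.lookup b 0" and "b1 = Poly_Mapping.lookup b 1"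
    and "c0 = Poly_Mapping.lookup c 0" and "c1 = Poly_Mapping.lookup c 1"
  have R: "r2_brk t \<beta> v b = r2_scale b0 (?X v) + r2_scale b1 (?E v)"
    "r2_brk t \<beta> v c = r2_scale c0 (?X v) + r2_scale c1 (?E v)" for v
    unfolding b0_def b1_def c0_def c1_def by (rule r2_brk_expand_right)+
  have coords: "Poly_Mapping.lookup (r2_brk t \<beta> b c) 0 = 0"
    "Poly_Mapping.lookup (r2_brk t \<beta> b c) 1 = c0 * b1 - c1 * b0"
    using lookup_r2_brk_x_0[of t \<beta> b] lookup_r2_brk_x_1[of t \<beta> b]
      lookup_r2_brk_e1[of t \<beta> b 0] lookup_r2_brk_e1[of t \<beta> b 1]
    unfolding R by (simp_all add: lookup_add b0_def b1_def)
  have XE: "?X (?E a) = ?E (?X a) + ?E a"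
    using r2_brk_commutator[of t \<beta> a] by (simp add: algebra_simps)
  have "r2_brk t \<beta> a (r2_brk t \<beta> b c) = r2_scale (c0 * b1 - c1 * b0) (?E a)"
    unfolding r2_brk_expand_right[of t \<beta> a "r2_brk t \<beta> b c"] coords by simp
  moreover have "r2_brk t \<beta> (r2_brk t \<beta> a b) c - r2_brk t \<beta> (r2_brk t \<beta> a c) b
      = r2_scale (c0 * b1 - c1 * b0) (?E a)"
    unfolding R r2_brk_left_simps XE
    by (rule poly_mapping_eqI) (simp add: lookup_add lookup_minus algebra_simps)
  ultimately show "r2_brk t \<beta> a (r2_brk t \<beta> b c)
      = r2_brk t \<beta> (r2_brk t \<beta> a b) c - r2_brk t \<beta> (r2_brk t \<beta> a c) b"
    by simp
qed

section \<open>The center\<close>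

lemma r2_center: "leibniz_algebra.center (r2_brk t \<beta>) = {0}"
proof -
  interpret L: leibniz_algebra r2_scale "r2_brk t \<beta>" by (rule leibniz_algebra_r2)
  have "a = 0" if "a \<in> L.center" for a
  proof (rule poly_mapping_eqI)
    fix m
    have l: "r2_brk t \<beta> a b = 0" and r: "r2_brk t \<beta> b a = 0" for b
      using that by (auto simp: L.center_def)
    have e2: "r2_scale (Poly_Mapping.lookup a 0) (r2_e 2
          + (\<Sum>k=3..t. r2_scale (\<beta> k) (r2_e k)))
        + r2_scale (Poly_Mapping.lookup a 1) (r2_e 3) = 0"
      using r[of "r2_e 2"] r2_brk_expand_right[of t \<beta> "r2_e 2" a]
      by (simp add: r2_brk_e r2_basis_brk_def)
    have a0: "Poly_Mapping.lookup a 0 = 0"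
      using arg_cong[OF e2, of "\<lambda>v. Poly_Mapping.lookup v 2"]
      by (simp add: lookup_add lookup_sum)
    have a1: "Poly_Mapping.lookup a 1 = 0"
      using arg_cong[OF e2, of "\<lambda>v. Poly_Mapping.lookup v 3"] a0
      by (simp add: lookup_add)
    have "Poly_Mapping.lookup a m = 0" if "m \<ge> 2"
      using lookup_r2_brk_e1[of t \<beta> a "m + 1"] l[of "r2_e 1"] that by simp
    with a0 a1 show "Poly_Mapping.lookup a m = Poly_Mapping.lookup 0 m"
      by (cases "m = 0"; cases "m = 1") (auto simp: not_less_eq_eq)
  qed
  moreover have "0 \<in> L.center"
    by (simp add: L.center_def r2_brk_left_simps r2_brk_right_simps)
  ultimately show ?thesis by blast
qed

section \<open>Derivations\<close>

lemma linear_r2_brk_funpow: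
  "Vector_Spaces.linear r2_scale r2_scale ((\<lambda>a. r2_brk t \<beta> a b) ^^ n)"
  by (rule r2_linearI; induction n) (simp_all add: r2_brk_left_simps)

lemma r2_e_funpow:
  "i \<ge> 2 \<Longrightarrow> ((\<lambda>a. r2_brk t \<beta> a (r2_e 1)) ^^ n) (r2_e i) = r2_e (n + i)"
  by (induction n) (simp_all add: r2_brk_e r2_basis_brk_def)

text \<open>
  The operator \<open>[\<cdot>, x]\<close> on the span of \<open>e\<^sub>2, e\<^sub>3, \<dots>\<close> is a diagonal part plus a polynomial in the
  shift \<open>E\<close>.  Since derivations killing \<open>e\<^sub>1\<close> commute with \<open>E\<close>, the polynomial part will drop out
  and leave only the diagonal one.
\<close>

lemma lookup_r2_brk_x_tail:
  assumes "Poly_Mapping.lookup u 0 = 0" "Poly_Mapping.lookup u 1 = 0"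
  shows "Poly_Mapping.lookup (r2_brk t \<beta> u (r2_e 0)) m =
    (of_nat m - 1) * Poly_Mapping.lookup u m
    + Poly_Mapping.lookup
        (\<Sum>k=3..t. r2_scale (\<beta> k) (((\<lambda>a. r2_brk t \<beta> a (r2_e 1)) ^^ (k - 2)) u)) m"
    (is "?P u")
proof (rule r2_induct_keys[where v = u and P = ?P])
  note funpow_simps = r2_pair.linear_0[OF linear_r2_brk_funpow]
    r2_pair.linear_add[OF linear_r2_brk_funpow] r2_pair.linear_scale[OF linear_r2_brk_funpow]
  show "?P 0"
    by (simp add: r2_brk_left_simps funpow_simps)
  show "?P (v + w)" if "?P v" "?P w" for v w
    using that by (simp add: r2_brk_left_simps funpow_simps lookup_add r2.scale_right_distrib
        sum.distrib distrib_left)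
  fix c and i :: nat
  assume "i \<in> Poly_Mapping.keys u"
  with assms have i: "i \<ge> 2"
    by (metis One_nat_def in_keys_iff less_2_cases not_le)
  have "(\<Sum>k=3..t. r2_scale (\<beta> k)
        (((\<lambda>a. r2_brk t \<beta> a (r2_e 1)) ^^ (k - 2)) (r2_scale c (r2_e i))))
      = r2_scale c (\<Sum>k=3..t. r2_scale (\<beta> k) (r2_e (k + i - 2)))"
    unfolding r2.scale_sum_right
    by (rule sum.cong)
       (auto simp: funpow_simps r2_e_funpow[OF i, unfolded One_nat_def] mult.commute)
  then show "?P (r2_scale c (r2_e i))"
    using i by (auto simp: r2_brk_left_simps r2_brk_e r2_basis_brk_def lookup_add lookup_minus algebra_simps)
qed

lemma r2_derivation_eq_zero:
  assumes d: "leibniz_algebra.derivation r2_scale (r2_brk t \<beta>) d"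
    and x1: "Poly_Mapping.lookup (d (r2_e 0)) 1 = 0"
    and e11: "Poly_Mapping.lookup (d (r2_e 1)) 1 = 0"
  shows "d v = 0"
proof -
  interpret L: leibniz_algebra r2_scale "r2_brk t \<beta>" by (rule leibniz_algebra_r2)
  let ?E = "\<lambda>a. r2_brk t \<beta> a (r2_e 1)"
  define u where "u = d (r2_e 0)"
  have lin: "Vector_Spaces.linear r2_scale r2_scale d"
    and der: "d (r2_brk t \<beta> a b) = r2_brk t \<beta> (d a) b + r2_brk t \<beta> a (d b)" for a b
    using d by (auto simp: L.derivation_def)
  note d_simps = r2_pair.linear_0[OF lin] r2_pair.linear_add[OF lin] r2_pair.linear_diff[OF lin]
    r2_pair.linear_scale[OF lin] r2_pair.linear_sum[OF lin]

  have de1: "d (r2_e 1) = 0"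
  proof (rule poly_mapping_eqI)
    fix m
    have "r2_brk t \<beta> (r2_e 1) (d (r2_e 1))
        = r2_scale (Poly_Mapping.lookup (d (r2_e 1)) 0) (r2_e 1)"
      using r2_brk_expand_right[of t \<beta> "r2_e 1" "d (r2_e 1)"]
      by (simp add: r2_brk_e r2_basis_brk_def)
    then have eq: "?E (d (r2_e 1)) + r2_scale (Poly_Mapping.lookup (d (r2_e 1)) 0) (r2_e 1) = 0"
      using der[of "r2_e 1" "r2_e 1"] by (simp add: r2_brk_e r2_basis_brk_def d_simps)
    have eqm: "Poly_Mapping.lookup (?E (d (r2_e 1))) n
        + Poly_Mapping.lookup (d (r2_e 1)) 0 * (if 1 = n then 1 else 0) = 0" for n
      using arg_cong[OF eq, of "\<lambda>v. Poly_Mapping.lookup v n"] by (simp add: lookup_add)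
    \<comment> \<open>At index \<open>1\<close> the two summands cancel, so the \<open>x\<close>-coordinate is read off at index \<open>2\<close>.\<close>
    have "Poly_Mapping.lookup (d (r2_e 1)) 0 = 0"
      using eqm[of 2] unfolding lookup_r2_brk_e1 by simp
    moreover have "Poly_Mapping.lookup (d (r2_e 1)) m = 0" if "m \<ge> 2"
      using eqm[of "m + 1"] that unfolding lookup_r2_brk_e1 by simp
    ultimately show "Poly_Mapping.lookup (d (r2_e 1)) m = Poly_Mapping.lookup 0 m"
      using e11 by (cases "m = 0"; cases "m = 1") (auto simp: not_less_eq_eq)
  qed

  have u0: "Poly_Mapping.lookup u 0 = 0"
  proof -
    have "r2_brk t \<beta> (r2_e 1) u = 0"
      using der[of "r2_e 1" "r2_e 0"] de1
      by (simp add: r2_brk_e r2_basis_brk_def r2_brk_left_simps u_def)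
    then have "r2_scale (Poly_Mapping.lookup u 0) (r2_e 1) = 0"
      using r2_brk_expand_right[of t \<beta> "r2_e 1" u]
      by (simp add: r2_brk_e r2_basis_brk_def)
    from arg_cong[OF this, of "\<lambda>v. Poly_Mapping.lookup v 1"] show ?thesis by simp
  qed
  have u1: "Poly_Mapping.lookup u 1 = 0"
    using x1 by (simp add: u_def)

  have comm: "d ((?E ^^ n) a) = (?E ^^ n) (d a)" for n a
    by (induction n) (simp_all add: der de1[unfolded One_nat_def] r2_brk_right_simps)
  have de2: "d (r2_e 2) = ?E u"
    using der[of "r2_e 0" "r2_e 1"] de1
    by (simp add: r2_brk_e r2_basis_brk_def d_simps r2_brk_right_simps u_def)
  have dek: "d (r2_e k) = (?E ^^ (k - 1)) u" if "k \<ge> 2" for k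
  proof -
    have "(?E ^^ (k - 2)) (r2_e 2) = r2_e k"
      using r2_e_funpow[OF order.refl, of "k - 2" t \<beta>] that by (simp only: le_add_diff_inverse2)
    then have "d (r2_e k) = (?E ^^ (k - 2)) (d (r2_e 2))"
      using comm[of "k - 2" "r2_e 2"] by simp
    also have "\<dots> = (?E ^^ Suc (k - 2)) u"
      unfolding de2 by (simp only: funpow_Suc_right o_apply)
    also have "Suc (k - 2) = k - 1"
      using that by simp
    finally show ?thesis .
  qed

  have u: "u = 0"
  proof (rule poly_mapping_eqI)
    fix m
    have xu: "r2_brk t \<beta> (r2_e 0) u = 0"
      using r2_brk_expand_right[of t \<beta> "r2_e 0" u] u0 u1 by simp
    have "r2_brk t \<beta> u (r2_e 0) = d (r2_brk t \<beta> (r2_e 0) (r2_e 0))"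
      using der[of "r2_e 0" "r2_e 0"] xu by (simp add: u_def)
    also have "\<dots> = (\<Sum>k=2..t-1. r2_scale (\<beta> (Suc k)) ((?E ^^ (Suc k - 2)) u))"
      using dek by (simp add: r2_brk_e r2_basis_brk_def d_simps numeral_2_eq_2)
    also have "\<dots> = (\<Sum>k=3..t. r2_scale (\<beta> k) ((?E ^^ (k - 2)) u))"
      by (rule r2_sum_shift)
    finally have "(of_nat m - 1) * Poly_Mapping.lookup u m = 0"
      using lookup_r2_brk_x_tail[OF u0 u1, of t \<beta> m] by simp
    then show "Poly_Mapping.lookup u m = Poly_Mapping.lookup 0 m"
      using u1 by auto
  qed

  have "d (r2_e i) = 0" for i
  proof -
    consider "i = 0" | "i = 1" | "i \<ge> 2" by linarith
    then show ?thesis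
      using de1 dek[of i] u r2_pair.linear_0[OF linear_r2_brk_funpow] by cases (auto simp: u_def)
  qed
  then show ?thesis
    using r2_linear_eqI[OF lin r2_pair.linear_zero, of v] by simp
qed

theorem theorem3p9:
  fixes t :: nat and \<beta> :: "nat \<Rightarrow> complex"
  shows "leibniz_algebra r2_scale (r2_brk t \<beta>) \<and>
         leibniz_algebra.complete_algebra r2_scale (r2_brk t \<beta>)"
proof
  show "leibniz_algebra r2_scale (r2_brk t \<beta>)" by (rule leibniz_algebra_r2)
  interpret L: leibniz_algebra r2_scale "r2_brk t \<beta>" by (rule leibniz_algebra_r2)
  have "L.inner d" if d: "L.derivation d" for d
  proof -
    \<comment> \<open>Right multiplication by \<open>a\<close> sends \<open>e\<^sub>1\<close> to \<open>a\<^sub>0 e\<^sub>1\<close>, and \<open>x\<close> to a vector with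
      \<open>e\<^sub>1\<close>-coordinate \<open>- a\<^sub>1\<close>.\<close>
    define a where "a = r2_scale (Poly_Mapping.lookup (d (r2_e 1)) 1) (r2_e 0)
      - r2_scale (Poly_Mapping.lookup (d (r2_e 0)) 1) (r2_e 1)"
    have a01: "Poly_Mapping.lookup a 0 = Poly_Mapping.lookup (d (r2_e 1)) 1"
      "Poly_Mapping.lookup a 1 = - Poly_Mapping.lookup (d (r2_e 0)) 1"
      by (simp_all add: a_def lookup_minus)
    have brk1: "Poly_Mapping.lookup (r2_brk t \<beta> v a) 1
        = Poly_Mapping.lookup a 0 * Poly_Mapping.lookup v 1
          - Poly_Mapping.lookup a 1 * Poly_Mapping.lookup v 0" for v
      unfolding r2_brk_expand_right[of t \<beta> v a] lookup_add lookup_r2_scale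
        lookup_r2_brk_x_1 lookup_r2_brk_e1 by simp
    have "d v - r2_brk t \<beta> v a = 0" for v
    proof (rule r2_derivation_eq_zero[where d = "\<lambda>v. d v - r2_brk t \<beta> v a"])
      show "L.derivation (\<lambda>v. d v - r2_brk t \<beta> v a)"
        using d L.derivation_right_mult by (rule L.derivation_diff)
    qed (simp_all only: lookup_minus brk1, simp_all add: a01[unfolded One_nat_def])
    then have "d = (\<lambda>b. r2_brk t \<beta> b a)" by auto
    then show ?thesis by (auto simp: L.inner_def)
  qed
  then show "L.complete_algebra"
    by (simp add: L.complete_algebra_def r2_center)
qed

end
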